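(* Let $G$ be a game. Then $G \geqslant^-_{\mathcal{D}} 0$ if and only if $G \geqslant^-_{\mathcal{DB}} 0$.
   Context: A game is a finite two-player combinatorial game, defined recursively by $G=\{G^{\mathbf L}\mid G^{\mathbf R}\}$, where $G^{\mathbf L}$ and $G^{\mathbf R}$ are the finite sets of Left options and Right options, which are themselves games. The game $0=\{\cdot\mid\cdot\}$ has no options. The sum is $G+H=\{G^{\mathbf L}+H,\,G+H^{\mathbf L}\mid G^{\mathbf R}+H,\,G+H^{\mathbf R}\}$. Left and Right alternate moves. Under misère play, a player who cannot move on their turn wins. The misère outcome $o^-(G)$ is $\mathcal L$ (Left wins whoever starts), $\mathcal R$ (Right wins whoever starts), $\mathcal N$ (the first player wins) or $\mathcal P$ (the second player wins). Outcomes are partially ordered by $\mathcal R<\mathcal N<\mathcal L$ and $\mathcal R<\mathcal P<\mathcal L$, with $\mathcal N$ and $\mathcal P$ incomparable. For a set $\mathcal U$ of games and games $G,H$ (not necessarily in $\mathcal U$), $G\geqslant^-_{\mathcal U}H$ means $o^-(G+X)\geqslant o^-(H+X)$ for every $X\in\mathcal U$. A game is dicot if it is $0$, or if it has both Left and Right options and all of them are dicot. A game is binary if it has at most one Left option and at most one Right option, and all these options, if any, are binary. $\mathcal D$ is the set of all dicot games and $\mathcal{DB}$ is the set of all games that are both binary and dicot. *)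

theory Defs
  imports Main "HOL-Library.FSet"
begin

text \<open>
  Games are taken as literal forms: two games are equal iff their finite sets of
  Left options and of Right options coincide, hereditarily.
\<close>

datatype game = Game (left_opts: "game fset") (right_opts: "game fset")

lemma size_left_opts [termination_simp]: "G' |\<in>| left_opts G \<Longrightarrow> size G' < size G"
  by (cases G) (auto simp: less_Suc_eq_le intro!: trans_le_add1
      member_le_sum[where f = "\<lambda>x. Suc (size x)", THEN Suc_leD, THEN order_trans])

lemma size_right_opts [termination_simp]: "G' |\<in>| right_opts G \<Longrightarrow> size G' < size G"
  by (cases G) (auto simp: less_Suc_eq_le intro!: trans_le_add2
      member_le_sum[where f = "\<lambda>x. Suc (size x)", THEN Suc_leD, THEN order_trans])

instantiation game :: "{zero, plus}"
begin

definition zero_game :: game where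
  "0 = Game {||} {||}"

function plus_game :: "game \<Rightarrow> game \<Rightarrow> game" where
  "G + H = Game
     ((\<lambda>G'. G' + H) |`| left_opts G |\<union>| (\<lambda>H'. G + H') |`| left_opts H)
     ((\<lambda>G'. G' + H) |`| right_opts G |\<union>| (\<lambda>H'. G + H') |`| right_opts H)"
  by pat_completeness auto
termination
  by (relation "measure (\<lambda>(G, H). size G + size H)")
    (auto dest: size_left_opts size_right_opts)

declare plus_game.simps [simp del]

instance ..

end

datatype player = Left | Right

fun opponent :: "player \<Rightarrow> player" where
  "opponent Left = Right"
| "opponent Right = Left"

fun options :: "player \<Rightarrow> game \<Rightarrow> game fset" where
  "options Left G = left_opts G"
| "options Right G = right_opts G"

lemma size_option_less [termination_simp]: "G' |\<in>| options p G \<Longrightarrow> size G' < size G"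
  by (cases p) (auto dest: size_left_opts size_right_opts)

text \<open>
  Under misere play, the player to move wins iff they have no move, or some move
  leads to a position from which the opponent, now to move, does not win.
  As play always ends with a winner, the second player wins exactly when the first does not.
\<close>

function wins_first :: "player \<Rightarrow> game \<Rightarrow> bool" where
  "wins_first p G \<longleftrightarrow>
     options p G = {||} \<or> (\<exists>G' |\<in>| options p G. \<not> wins_first (opponent p) G')"
  by pat_completeness auto
termination
  by (relation "measure (\<lambda>(p, G). size G)") (auto dest: size_option_less)

declare wins_first.simps [simp del]

definition wins_second :: "player \<Rightarrow> game \<Rightarrow> bool" where
  "wins_second p G \<longleftrightarrow> \<not> wins_first (opponent p) G"

datatype outcome = OutL | OutR | OutN | OutP

instantiation outcome :: order
begin

definition less_eq_outcome :: "outcome \<Rightarrow> outcome \<Rightarrow> bool" where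
  "a \<le> b \<longleftrightarrow> a = b \<or> a = OutR \<or> b = OutL"

definition less_outcome :: "outcome \<Rightarrow> outcome \<Rightarrow> bool" where
  "a < b \<longleftrightarrow> a \<le> b \<and> a \<noteq> (b :: outcome)"

instance
  by standard (auto simp: less_eq_outcome_def less_outcome_def)

end

definition misere_outcome :: "game \<Rightarrow> outcome" where
  "misere_outcome G =
     (if wins_first Left G \<and> wins_second Left G then OutL
      else if wins_first Right G \<and> wins_second Right G then OutR
      else if wins_first Left G \<and> wins_first Right G then OutN
      else OutP)"

definition misere_ge :: "game set \<Rightarrow> game \<Rightarrow> game \<Rightarrow> bool" where
  "misere_ge U G H \<longleftrightarrow> (\<forall>X\<in>U. misere_outcome (G + X) \<ge> misere_outcome (H + X))"

inductive dicot :: "game \<Rightarrow> bool" where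
  dicot_zero: "dicot 0"
| dicot_both:
    "left_opts G \<noteq> {||} \<Longrightarrow> right_opts G \<noteq> {||} \<Longrightarrow>
     (\<And>G'. G' |\<in>| left_opts G \<Longrightarrow> dicot G') \<Longrightarrow>
     (\<And>G'. G' |\<in>| right_opts G \<Longrightarrow> dicot G') \<Longrightarrow> dicot G"

inductive binary :: "game \<Rightarrow> bool" where
  "fcard (left_opts G) \<le> 1 \<Longrightarrow> fcard (right_opts G) \<le> 1 \<Longrightarrow>
   (\<And>G'. G' |\<in>| left_opts G \<Longrightarrow> binary G') \<Longrightarrow>
   (\<And>G'. G' |\<in>| right_opts G \<Longrightarrow> binary G') \<Longrightarrow> binary G"

definition dicots :: "game set" where
  "dicots = {G. dicot G}"

definition binary_dicots :: "game set" where
  "binary_dicots = {G. binary G \<and> dicot G}"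

end

theory Submission imports Defs begin

text \<open>
  Call \<open>G\<close> good if Left wins \<open>G\<close> moving first and every Right option of \<open>G\<close> has a good
  Left option. Good games satisfy \<open>G \<ge> 0\<close> modulo dicots: Left follows a winning strategy
  on \<open>X\<close> and answers each Right move in \<open>G\<close> by reverting it to a good game.

  For the converse, there are binary dicots \<open>K\<close> so bad for Left that Right wins \<open>G + K\<close>
  whoever starts, for all \<open>G\<close> of bounded size. Used as threats, they restrict where Left and
  Right can move, so that starting from \<open>X = 0\<close> and iterating \<open>X \<mapsto> {{K | X} | K}\<close> one gets a
  single binary dicot which Left wins moving first, but such that Left, moving first, loses
  \<open>G + X\<close> for all games \<open>G\<close> of bounded size that are not good. A uniform \<open>X\<close> is essential:
  with only one option available one cannot prepare a separate answer for each \<open>G\<close>.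
\<close>

section \<open>Sums and comparison with 0 under misere play\<close>

lemma options_zero [simp]: "options p 0 = {||}"
  by (cases p) (simp_all add: zero_game_def)

lemma opts_zero [simp]: "left_opts 0 = {||}" "right_opts 0 = {||}"
  by (simp_all add: zero_game_def)

lemma options_plus:
  "options p (G + H) = (\<lambda>G'. G' + H) |`| options p G |\<union>| (\<lambda>H'. G + H') |`| options p H"
  by (cases p; subst plus_game.simps) simp_all

lemma zero_plus_game: "0 + (G :: game) = G"
proof (induction "size G" arbitrary: G rule: less_induct)
  case less
  have "(\<lambda>G'. 0 + G') |`| options p G = options p G" for p
    using less[OF size_option_less] by (force simp: image_iff)
  then have "options p (0 + G) = options p G" for p
    by (simp add: options_plus)
  from this[of Left] this[of Right] show ?case
    by (simp add: game.expand)
qed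

lemma plus_zero_game: "(G :: game) + 0 = G"
proof (induction "size G" arbitrary: G rule: less_induct)
  case less
  have "(\<lambda>G'. G' + 0) |`| options p G = options p G" for p
    using less[OF size_option_less] by (force simp: image_iff)
  then have "options p (G + 0) = options p G" for p
    by (simp add: options_plus)
  from this[of Left] this[of Right] show ?case
    by (simp add: game.expand)
qed

lemma wins_first_plus:
  "wins_first p (G + H) \<longleftrightarrow>
     options p G = {||} \<and> options p H = {||} \<or>
     (\<exists>G'. G' |\<in>| options p G \<and> \<not> wins_first (opponent p) (G' + H)) \<or>
     (\<exists>H'. H' |\<in>| options p H \<and> \<not> wins_first (opponent p) (G + H'))"
  by (subst wins_first.simps) (auto simp: options_plus)

lemma wins_first_zero [simp]: "wins_first p 0"
  by (simp add: wins_first.simps[of p 0])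

text \<open>The outcome order is a product of two two-element orders: one records who wins when Left
  starts, the other who wins when Right starts.\<close>

lemma misere_outcome_le_iff:
  "misere_outcome H \<le> misere_outcome G \<longleftrightarrow>
     (wins_first Left H \<longrightarrow> wins_first Left G) \<and> (wins_first Right G \<longrightarrow> wins_first Right H)"
  by (auto simp: misere_outcome_def wins_second_def less_eq_outcome_def)

lemma misere_ge_zero_iff:
  "misere_ge U G 0 \<longleftrightarrow>
     (\<forall>X\<in>U. (wins_first Left X \<longrightarrow> wins_first Left (G + X)) \<and>
            (wins_first Right (G + X) \<longrightarrow> wins_first Right X))"
  by (simp add: misere_ge_def misere_outcome_le_iff zero_plus_game)

section \<open>Good games are at least 0 modulo dicots\<close>

lemma dicot_option: "dicot X \<Longrightarrow> X' |\<in>| options p X \<Longrightarrow> dicot X'"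
  by (cases p; erule dicot.cases) (auto simp: zero_game_def)

lemma dicot_end: "dicot X \<Longrightarrow> options p X = {||} \<Longrightarrow> X = 0"
  by (cases p; erule dicot.cases) auto

inductive good :: "game \<Rightarrow> bool" where
  "wins_first Left G \<Longrightarrow>
   (\<And>G'. G' |\<in>| right_opts G \<Longrightarrow> \<exists>G''. G'' |\<in>| left_opts G' \<and> good G'') \<Longrightarrow> good G"

lemma good_plus_dicot:
  assumes "good G" "dicot X"
  shows "(wins_first Left X \<longrightarrow> wins_first Left (G + X)) \<and>
         (wins_first Right (G + X) \<longrightarrow> wins_first Right X)"
  using assms
proof (induction "size G + size X" arbitrary: G X rule: less_induct)
  case less
  show ?case
  proof (cases "X = 0")
    case True
    then show ?thesis
      using less.prems(1) by (auto simp: plus_zero_game good.simps[of G])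
  next
    case False
    have IH: "(wins_first Left X' \<longrightarrow> wins_first Left (G + X')) \<and>
        (wins_first Right (G + X') \<longrightarrow> wins_first Right X')" if "X' |\<in>| options p X" for p X'
      using less.hyps[of G X'] that less.prems size_option_less dicot_option by fastforce
    show ?thesis
    proof (intro conjI impI)
      assume "wins_first Left X"
      \<comment> \<open>A nonzero dicot has a Left option, so Left wins \<open>X\<close> by an
        actual move and not by being stuck.\<close>
      with False less.prems(2) obtain X' where
        X': "X' |\<in>| options Left X" "\<not> wins_first Right X'"
        by (auto simp: wins_first.simps[of Left X] dest: dicot_end[of X Left])
      with IH have "\<not> wins_first Right (G + X')"
        by blast
      with X' show "wins_first Left (G + X)"
        by (auto simp: wins_first_plus[of Left])
    next
      assume "wins_first Right (G + X)"
      then consider "options Right X = {||}"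
        | G' where "G' |\<in>| options Right G" "\<not> wins_first Left (G' + X)"
        | X' where "X' |\<in>| options Right X" "\<not> wins_first Left (G + X')"
        by (auto simp: wins_first_plus[of Right])
      then show "wins_first Right X"
      proof cases
        case 1
        then show ?thesis by (simp add: wins_first.simps[of Right X])
      next
        case (2 G')
        with less.prems(1) obtain G'' where G'': "G'' |\<in>| options Left G'" "good G''"
          by (auto simp: good.simps[of G])
        with 2 have "wins_first Right (G'' + X)"
          by (auto simp: wins_first_plus[of Left])
        moreover have "size G'' < size G"
          using size_option_less[OF G''(1)] size_option_less[OF 2(1)] by simp
        ultimately show ?thesis
          using less.hyps[of G'' X] G'' less.prems by auto
      next
        case (3 X')
        with IH have "\<not> wins_first Left X'" by blast
        with 3 show ?thesis by (auto simp: wins_first.simps[of Right X])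
      qed
    qed
  qed
qed

section \<open>Binary dicots that crush Left beside any small game\<close>

definition node :: "game \<Rightarrow> game \<Rightarrow> game" where
  "node A B = Game {|A|} {|B|}"

lemma opts_node [simp]: "left_opts (node A B) = {|A|}" "right_opts (node A B) = {|B|}"
  by (simp_all add: node_def)

lemma zero_in_binary_dicots [simp]: "0 \<in> binary_dicots"
  unfolding binary_dicots_def by (simp add: dicot_zero fcard_fempty binary.simps[of 0])

lemma node_in_binary_dicots [simp]:
  "A \<in> binary_dicots \<Longrightarrow> B \<in> binary_dicots \<Longrightarrow> node A B \<in> binary_dicots"
  by (simp add: binary_dicots_def node_def fcard_fempty fcard_finsert_if
      binary.simps[of "Game _ _"] dicot.simps[of "Game _ _"])

primrec stack :: "game \<Rightarrow> nat \<Rightarrow> game" where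
  "stack Z 0 = 0"
| "stack Z (Suc m) = node (stack Z m) Z"

text \<open>
  The stack lets Left waste time while Right plays in \<open>G\<close>. Once Right cannot move in \<open>G\<close>, he
  moves to \<open>node 0 (crusher d)\<close>: taking the option \<open>0\<close> loses at once for Left, and after a
  Left move in \<open>G\<close> the next crusher suffices for what remains.
\<close>

primrec crusher :: "nat \<Rightarrow> game" where
  "crusher 0 = 0"
| "crusher (Suc d) = stack (node 0 (crusher d)) (Suc d)"

lemma stack_in_binary_dicots [simp]: "Z \<in> binary_dicots \<Longrightarrow> stack Z m \<in> binary_dicots"
  by (induction m) simp_all

lemma crusher_in_binary_dicots [simp]: "crusher d \<in> binary_dicots"
  by (induction d) (simp_all del: stack.simps)

text \<open>A Left move either shrinks \<open>G\<close> or removes one stack level; since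
  \<open>size G < m\<close> is strict, the condition \<open>size H \<le> m\<close> survives
  both.\<close>

lemma not_wins_first_Left_stack:
  assumes "\<And>H m. size H \<le> size G \<Longrightarrow> size H \<le> m \<Longrightarrow> wins_first Right (H + stack Z m)"
    and "size G < m"
  shows "\<not> wins_first Left (G + stack Z m)"
proof -
  from assms(2) obtain k where m: "m = Suc k" "size G \<le> k"
    by (cases m) auto
  have "wins_first Right (G' + stack Z m)" if "G' |\<in>| options Left G" for G'
    using assms(1)[of G' m] size_option_less[OF that] assms(2) by simp
  moreover have "wins_first Right (G + stack Z k)"
    using assms(1) m by simp
  ultimately show ?thesis
    using m by (auto simp: wins_first_plus[of Left])
qed

lemma wins_first_Right_stack:
  assumes "\<And>H. size H < size G \<Longrightarrow> \<not> wins_first Left (H + C)"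
    and "size G \<le> m"
  shows "wins_first Right (G + stack (node 0 C) m)"
  using assms
proof (induction "size G" arbitrary: G m rule: less_induct)
  case less
  let ?Z = "node 0 C"
  show ?case
  proof (cases "options Right G = {||}")
    case True
    show ?thesis
    proof (cases m)
      case 0
      with True show ?thesis by (simp add: wins_first_plus[of Right])
    next
      case (Suc k)
      have "wins_first Right (G' + ?Z)" if "G' |\<in>| options Left G" for G'
        using less.prems(1)[OF size_option_less[OF that]] by (auto simp: wins_first_plus[of Right])
      moreover have "wins_first Right (G + 0)"
        using True by (simp add: wins_first_plus[of Right])
      ultimately have "\<not> wins_first Left (G + ?Z)"
        by (auto simp: wins_first_plus[of Left])
      with Suc show ?thesis
        by (auto simp: wins_first_plus[of Right])
    qed
  next
    case False
    then obtain G' where G': "G' |\<in>| options Right G" by auto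
    note small = size_option_less[OF G']
    \<comment> \<open>Any Right move in \<open>G\<close> will do: it makes
      \<open>size G' < m\<close> strict, which pays for a Left move in the stack.\<close>
    have "\<not> wins_first Left (G' + stack ?Z m)"
    proof (rule not_wins_first_Left_stack)
      show "wins_first Right (H + stack ?Z k)" if "size H \<le> size G'" "size H \<le> k" for H k
        using less.hyps[of H k] less.prems(1) that small by simp
    qed (use small less.prems in auto)
    with G' show ?thesis
      by (auto simp: wins_first_plus[of Right])
  qed
qed

text \<open>The stack height \<open>Suc d\<close> exceeds \<open>size G\<close>, and the inner
  crusher only has to handle games of size below \<open>d\<close>, where induction applies.\<close>

lemma not_wins_first_Left_crusher:
  "size G < d \<Longrightarrow> \<not> wins_first Left (G + crusher d)"
proof (induction d arbitrary: G)
  case (Suc d)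
  show ?case
    unfolding crusher.simps
  proof (rule not_wins_first_Left_stack)
    show "wins_first Right (H + stack (node 0 (crusher d)) m)"
      if "size H \<le> size G" "size H \<le> m" for H m
      using Suc that by (intro wins_first_Right_stack) auto
  qed (use Suc.prems in auto)
qed simp

lemma wins_first_Right_crusher:
  "size G < d \<Longrightarrow> wins_first Right (G + crusher d)"
  by (cases d) (auto simp del: stack.simps
      intro!: wins_first_Right_stack not_wins_first_Left_crusher)

section \<open>Separating games that are not good from 0\<close>

primrec separator :: "nat \<Rightarrow> nat \<Rightarrow> game" where
  "separator N 0 = 0"
| "separator N (Suc n) = node (node (crusher N) (separator N n)) (crusher N)"

lemma separator_in_binary_dicots [simp]: "separator N n \<in> binary_dicots"
  by (induction n) simp_all

text \<open>After Left's move the only Right reply leads to the previous separator, again with Left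
  to move.\<close>

lemma wins_first_Left_separator: "wins_first Left (separator N n)"
  by (induction n) (simp_all add: wins_first.simps[of _ "node _ _"])

text \<open>If Left loses \<open>G\<close> moving first, every \<open>n\<close> works, even 0, since
  Right can run the separator down. Otherwise each round must also shrink \<open>G\<close>, so
  \<open>n\<close> has to exceed its size.\<close>

lemma not_wins_first_Left_plus_separator:
  assumes "\<not> good G" "size G < N" "wins_first Left G \<Longrightarrow> size G < n"
  shows "\<not> wins_first Left (G + separator N n)"
  using assms
proof (induction n arbitrary: G)
  case 0
  then show ?case by (auto simp: plus_zero_game)
next
  case (Suc n)
  let ?X = "separator N n"
  let ?Y = "node (crusher N) ?X"
  have "wins_first Right (G + ?Y)"
  proof (cases "wins_first Left G")
    case False
    then have "\<not> wins_first Left (G + ?X)"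
      using Suc.prems by (intro Suc.IH) auto
    then show ?thesis
      by (auto simp: wins_first_plus[of Right])
  next
    case True
    \<comment> \<open>Right picks a move that Left cannot revert to a good game; every Left reply
      \<open>G''\<close> is smaller than \<open>G\<close>, so the bound persists for
      \<open>n\<close>.\<close>
    with Suc.prems(1) obtain G' where
      G': "G' |\<in>| options Right G" "\<And>G''. G'' |\<in>| options Left G' \<Longrightarrow> \<not> good G''"
      by (auto simp: good.simps[of G])
    have "wins_first Right (G'' + ?Y)" if "G'' |\<in>| options Left G'" for G''
    proof -
      have "size G'' < size G'" "size G' < size G"
        using that G' size_option_less by blast+
      then have "\<not> wins_first Left (G'' + ?X)"
        using Suc that G' True by auto
      then show ?thesis
        by (auto simp: wins_first_plus[of Right])
    qed
    \<comment> \<open>The only Left option of \<open>?Y\<close> is a crusher, which forces Left to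
      move in \<open>G'\<close>.\<close>
    moreover have "wins_first Right (G' + crusher N)"
      using size_option_less[OF G'(1)] Suc.prems by (intro wins_first_Right_crusher) simp
    ultimately have "\<not> wins_first Left (G' + ?Y)"
      by (auto simp: wins_first_plus[of Left])
    with G' show ?thesis
      by (auto simp: wins_first_plus[of Right])
  qed
  \<comment> \<open>If Left moves in \<open>G\<close> instead of the separator, Right carries out
    the threat \<open>crusher N\<close>.\<close>
  moreover have "wins_first Right (G' + separator N (Suc n))" if "G' |\<in>| options Left G" for G'
    using size_option_less[OF that] Suc.prems(2) not_wins_first_Left_crusher[of G' N]
    by (auto simp: wins_first_plus[of Right])
  ultimately show ?case
    by (auto simp: wins_first_plus[of Left])
qed

theorem theorem3p9:
  fixes G :: game
  shows "misere_ge dicots G 0 \<longleftrightarrow> misere_ge binary_dicots G 0"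
proof
  assume "misere_ge dicots G 0"
  then show "misere_ge binary_dicots G 0"
    by (simp add: misere_ge_def dicots_def binary_dicots_def)
next
  assume ge: "misere_ge binary_dicots G 0"
  have "good G"
  proof (rule ccontr)
    assume "\<not> good G"
    let ?X = "separator (Suc (size G)) (Suc (size G))"
    have "\<not> wins_first Left (G + ?X)"
      using \<open>\<not> good G\<close> by (intro not_wins_first_Left_plus_separator) simp_all
    moreover have "wins_first Left (G + ?X)"
      using ge wins_first_Left_separator separator_in_binary_dicots
      unfolding misere_ge_zero_iff by blast
    ultimately show False by blast
  qed
  then show "misere_ge dicots G 0"
    using good_plus_dicot by (simp add: misere_ge_zero_iff dicots_def)
qed

end
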